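(* The integer solutions of the equation $x^2+3y^2=4z^3$ are parametrized by the following family in four variables: a triple $(x,y,z)\in\mathbb{Z}^3$ satisfies $x^2+3y^2=4z^3$ if and only if there exist $a,b,c,d\in\mathbb{Z}$ such that $$\begin{aligned} x&=(c^2+cd+d^2)\bigl(3a^2b(c-d)+a^3(2c+d)-b^3(2c+d)-3ab^2(c+2d)\bigr),\\ y&=(c^2+cd+d^2)\bigl(3ab^2c+a^3d-b^3d+3a^2b(c+d)\bigr),\\ z&=(c^2+cd+d^2)(a^2+ab+b^2). \end{aligned}$$ *)

theory Defs imports Main begin

end

theory Submission imports Defs "HOL-Computational_Algebra.Primes" begin

text \<open>
  Work in the ring of Eisenstein integers \<open>s + t \<zeta>\<close>, where
  \<open>\<zeta> = (1 + \<surd>-3) / 2\<close> satisfies \<open>\<zeta>\<^sup>2 = \<zeta> - 1\<close> and the norm of \<open>s + t \<zeta>\<close> is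
  \<open>s\<^sup>2 + s t + t\<^sup>2\<close>. A solution has \<open>x \<equiv> y\<close> modulo 2, so \<open>u = (x + y \<surd>-3) / 2\<close> lies in
  this ring, and the equation says exactly that the norm of \<open>u\<close> is \<open>z\<^sup>3\<close>. With
  \<open>g = c + d \<zeta>\<close> and \<open>h = a + b \<zeta>\<close>, the parametric family is nothing but
  \<open>u = N(g) g h\<^sup>3\<close>, \<open>z = N(g) N(h)\<close>. Multiplicativity of the norm shows that the family
  consists of solutions; the content is that every \<open>u\<close> whose norm is a cube has this shape.

  The reason lies in the factorisation of \<open>u\<close>. The factors of \<open>u\<close> above a rational prime
  \<open>p\<close> that is a norm, \<open>p = w w'\<close> with \<open>w'\<close> the conjugate of \<open>w\<close>, have a total number
  divisible by three. Up to units, any three of them multiply to \<open>w\<^sup>3\<close> or \<open>w'\<^sup>3\<close>, which is absorbed by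
  the cube, or to \<open>p w\<close> or \<open>p w'\<close>, which has the form \<open>N(r) r\<close> and is absorbed by
  \<open>N(g) g\<close>. A prime \<open>p\<close> that is not a norm stays prime in the ring; it contributes \<open>p\<^sup>2\<close> to
  the norm, so its exponent in \<open>u\<close> is a multiple of three and it goes into the cube.

  Unique factorisation is not developed as such: the proof strips such triples of factors from
  \<open>u\<close> in an induction on \<open>z\<close> (\<open>norm_cube_imp_form\<close>). Two facts on a prime \<open>p\<close> dividing a
  norm \<open>N(u)\<close> carry it: if \<open>p = N(w)\<close>, then \<open>w\<close> or its conjugate divides \<open>u\<close>
  (\<open>split_off_factor\<close>), and if \<open>p\<close> is not a norm, then \<open>p\<close> divides \<open>u\<close>
  (\<open>prime_is_norm\<close>, which rests on division with remainder).
\<close>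

section \<open>The ring of Eisenstein integers\<close>

text \<open>
  \<open>Eis s t\<close> stands for \<open>s + t \<zeta>\<close> with the sixth root of unity \<open>\<zeta>\<close>. The basis with a cube
  root of unity would turn the norm into \<open>s\<^sup>2 - s t + t\<^sup>2\<close> and so not match the signs of the
  parametrisation.
\<close>

datatype eisenstein = Eis (fst_coord: int) (snd_coord: int)

instantiation eisenstein :: comm_ring_1
begin

definition "0 = Eis 0 0"
definition "1 = Eis 1 0"
definition "u + v = Eis (fst_coord u + fst_coord v) (snd_coord u + snd_coord v)"
definition "- u = Eis (- fst_coord u) (- snd_coord u)"
definition "u - v = Eis (fst_coord u - fst_coord v) (snd_coord u - snd_coord v)"
definition "u * v = Eis (fst_coord u * fst_coord v - snd_coord u * snd_coord v)
  (fst_coord u * snd_coord v + snd_coord u * fst_coord v + snd_coord u * snd_coord v)"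

instance
  by standard
    (auto simp: zero_eisenstein_def one_eisenstein_def plus_eisenstein_def uminus_eisenstein_def
      minus_eisenstein_def times_eisenstein_def algebra_simps)

end

lemmas eisenstein_ops =
  zero_eisenstein_def one_eisenstein_def plus_eisenstein_def uminus_eisenstein_def
  minus_eisenstein_def times_eisenstein_def

lemma of_int_eisenstein: "(of_int k :: eisenstein) = Eis k 0"
  by (induction k rule: int_induct[where k = 0]) (auto simp: eisenstein_ops)

text \<open>The conjugate of \<open>\<zeta>\<close> is \<open>1 - \<zeta>\<close>.\<close>

definition econj :: "eisenstein \<Rightarrow> eisenstein" where
  "econj u = Eis (fst_coord u + snd_coord u) (- snd_coord u)"

definition enorm :: "eisenstein \<Rightarrow> int" where
  "enorm u = (fst_coord u)\<^sup>2 + fst_coord u * snd_coord u + (snd_coord u)\<^sup>2"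

lemma enorm_Eis: "enorm (Eis a b) = a\<^sup>2 + a * b + b\<^sup>2"
  by (simp add: enorm_def)

lemma mult_econj: "u * econj u = of_int (enorm u)"
  by (cases u) (auto simp: of_int_eisenstein eisenstein_ops econj_def enorm_def algebra_simps power2_eq_square)

lemma econj_mult: "econj (u * v) = econj u * econj v"
  by (auto simp: eisenstein_ops econj_def algebra_simps)

lemma econj_econj [simp]: "econj (econj u) = u"
  by (cases u) (auto simp: econj_def)

lemma econj_of_int [simp]: "econj (of_int k) = of_int k"
  by (auto simp: of_int_eisenstein econj_def)

lemma enorm_econj [simp]: "enorm (econj u) = enorm u"
  by (auto simp: econj_def enorm_def algebra_simps power2_eq_square)

lemma enorm_mult: "enorm (u * v) = enorm u * enorm v"
  by (auto simp: eisenstein_ops enorm_def algebra_simps power2_eq_square)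

lemma enorm_of_int [simp]: "enorm (of_int k) = k\<^sup>2"
  by (auto simp: of_int_eisenstein enorm_def)

lemma enorm_one [simp]: "enorm 1 = 1"
  by (simp add: enorm_def one_eisenstein_def)

lemma enorm_power: "enorm (u ^ n) = enorm u ^ n"
  by (induction n) (simp_all add: enorm_mult)

text \<open>
  Completing the square. The right-hand side is the quadratic form \<open>x\<^sup>2 + 3 y\<^sup>2\<close> of the
  equation, and it makes the norm visibly positive definite.
\<close>

lemma four_enorm: "4 * enorm u = (2 * fst_coord u + snd_coord u)\<^sup>2 + 3 * (snd_coord u)\<^sup>2"
  by (simp add: enorm_def algebra_simps power2_eq_square)

lemma enorm_nonneg [simp]: "enorm u \<ge> 0"
proof -
  have "0 \<le> 4 * enorm u" unfolding four_enorm by simp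
  thus ?thesis by simp
qed

lemma enorm_eq_0_iff [simp]: "enorm u = 0 \<longleftrightarrow> u = 0"
proof
  assume "enorm u = 0"
  hence "(2 * fst_coord u + snd_coord u)\<^sup>2 + 3 * (snd_coord u)\<^sup>2 = 0"
    using four_enorm[of u] by simp
  moreover have "(2 * fst_coord u + snd_coord u)\<^sup>2 \<ge> 0" "(snd_coord u)\<^sup>2 \<ge> 0" by simp_all
  ultimately have "(snd_coord u)\<^sup>2 = 0" "(2 * fst_coord u + snd_coord u)\<^sup>2 = 0" by linarith+
  thus "u = 0" by (cases u) (simp add: zero_eisenstein_def)
qed (simp add: zero_eisenstein_def enorm_def)

instance eisenstein :: idom
proof
  fix u v :: eisenstein
  assume "u \<noteq> 0" "v \<noteq> 0"
  hence "enorm u * enorm v \<noteq> 0" by simp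
  thus "u * v \<noteq> 0" by (metis enorm_mult enorm_eq_0_iff)
qed

lemma of_int_eisenstein_eq_0_iff [simp]: "(of_int k :: eisenstein) = 0 \<longleftrightarrow> k = 0"
  by (simp add: of_int_eisenstein zero_eisenstein_def)

lemma of_int_dvd_Eis_iff: "of_int k dvd Eis a b \<longleftrightarrow> k dvd a \<and> k dvd b"
proof
  assume "of_int k dvd Eis a b"
  then obtain w where "Eis a b = of_int k * w" by (elim dvdE)
  thus "k dvd a \<and> k dvd b" by (simp add: of_int_eisenstein eisenstein_ops)
next
  assume "k dvd a \<and> k dvd b"
  then obtain a' b' where "a = k * a'" "b = k * b'" by (auto elim!: dvdE)
  hence "Eis a b = of_int k * Eis a' b'" by (simp add: of_int_eisenstein eisenstein_ops)
  thus "of_int k dvd Eis a b" by simp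
qed

lemma econj_dvd_econj: "u dvd v \<Longrightarrow> econj u dvd econj v"
  by (auto elim!: dvdE simp: econj_mult)

section \<open>Division with remainder and rational primes\<close>

lemma nearest_multiple:
  fixes u n :: int
  assumes "n > 0"
  obtains q where "4 * (u - q * n)\<^sup>2 \<le> n\<^sup>2"
proof
  define q where "q = (2 * u + n) div (2 * n)"
  define r where "r = (2 * u + n) mod (2 * n)"
  have "2 * (q * n) + r = 2 * u + n"
    using mult_div_mod_eq[of "2 * n" "2 * u + n"] by (simp add: q_def r_def mult_ac)
  moreover have "0 \<le> r" "r < 2 * n"
    using assms by (simp_all add: r_def)
  ultimately have "\<bar>2 * (u - q * n)\<bar> \<le> \<bar>n\<bar>"
    using assms unfolding right_diff_distrib by linarith
  hence "(2 * (u - q * n))\<^sup>2 \<le> n\<^sup>2" by (simp add: abs_le_square_iff)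
  thus "4 * (u - q * n)\<^sup>2 \<le> n\<^sup>2" unfolding power_mult_distrib by simp
qed

text \<open>
  Round both coordinates of \<open>u / v\<close> to the nearest integer. The errors \<open>e\<close>, \<open>f\<close> are at most
  \<open>1/2\<close> in absolute value, so \<open>e\<^sup>2 + e f + f\<^sup>2 \<le> 3/4 < 1\<close>. To stay within the integers,
  everything is multiplied by \<open>N(v)\<close>, with \<open>u / v\<close> replaced by \<open>u\<close> times the conjugate of
  \<open>v\<close>.
\<close>

lemma euclidean_division:
  assumes "v \<noteq> 0"
  obtains q where "enorm (u - q * v) < enorm v"
proof -
  define n where "n = enorm v"
  have n: "n > 0" using assms enorm_nonneg[of v] by (simp add: n_def less_le)
  obtain a b where ab: "u * econj v = Eis a b" by (cases "u * econj v")
  obtain q1 where q1: "4 * (a - q1 * n)\<^sup>2 \<le> n\<^sup>2" using nearest_multiple[OF n] .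
  obtain q2 where q2: "4 * (b - q2 * n)\<^sup>2 \<le> n\<^sup>2" using nearest_multiple[OF n] .
  define q where "q = Eis q1 q2"
  define s t where "s = a - q1 * n" and "t = b - q2 * n"
  have "(u - q * v) * econj v = u * econj v - q * (v * econj v)"
    by (simp add: algebra_simps)
  also have "\<dots> = Eis s t"
    unfolding ab mult_econj by (simp add: q_def s_def t_def of_int_eisenstein eisenstein_ops n_def)
  finally have "enorm (u - q * v) * n = enorm (Eis s t)"
    by (metis enorm_mult enorm_econj n_def)
  \<comment> \<open>From \<open>2 s t \<le> s\<^sup>2 + t\<^sup>2\<close>; the factor 8 keeps the coefficients integral once
    \<open>4 s\<^sup>2\<close> and \<open>4 t\<^sup>2\<close> are bounded by \<open>n\<^sup>2\<close>.\<close>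
  moreover have "8 * enorm (Eis s t) \<le> 12 * s\<^sup>2 + 12 * t\<^sup>2"
  proof -
    have "0 \<le> 4 * (s - t)\<^sup>2" by simp
    thus ?thesis by (simp add: enorm_Eis power2_eq_square algebra_simps)
  qed
  ultimately have "8 * (enorm (u - q * v) * n) \<le> 6 * n\<^sup>2"
    using q1 q2 unfolding s_def t_def by linarith
  also have "\<dots> < 8 * n\<^sup>2" using n by simp
  finally have "enorm (u - q * v) < n" using n by (simp add: power2_eq_square)
  thus ?thesis using that n_def by blast
qed

text \<open>
  The ideal generated by \<open>p\<close> and \<open>u\<close> is principal, and the norm of its generator \<open>g\<close> divides
  \<open>N(p) = p\<^sup>2\<close>. If \<open>g\<close> is a unit, multiplying a representation of \<open>g\<close> by the conjugate of
  \<open>u\<close> shows that \<open>p\<close> divides this conjugate, because it divides \<open>N(u)\<close>. If \<open>N(g) = p\<^sup>2\<close>,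
  then \<open>g\<close> is associated with \<open>p\<close> and divides \<open>u\<close>. Both contradict that \<open>p\<close> does not
  divide \<open>u\<close>, and only \<open>N(g) = p\<close> remains.
\<close>

lemma prime_is_norm:
  fixes p :: int
  assumes p: "prime p" and dvd: "p dvd enorm u" and ndvd: "\<not> of_int p dvd u"
  obtains w where "enorm w = p"
proof -
  define I where "I = {of_int p * r + u * s | r s. True}"
  have pI: "of_int p \<in> I" unfolding I_def by (rule CollectI, rule exI[of _ 1], rule exI[of _ 0]) simp
  have uI: "u \<in> I" unfolding I_def by (rule CollectI, rule exI[of _ 0], rule exI[of _ 1]) simp
  have closed: "x - q * y \<in> I" if xy: "x \<in> I" "y \<in> I" for x y q
  proof -
    obtain r s r' s' where "x = of_int p * r + u * s" "y = of_int p * r' + u * s'"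
      using xy unfolding I_def by blast
    hence "x - q * y = of_int p * (r - q * r') + u * (s - q * s')"
      by (simp add: algebra_simps)
    thus ?thesis unfolding I_def by blast
  qed
  have p0: "p > 0" using p by (simp add: prime_gt_0_int)
  have "\<exists>g. (g \<in> I \<and> g \<noteq> 0) \<and> (\<forall>y. y \<in> I \<and> y \<noteq> 0 \<longrightarrow> nat (enorm g) \<le> nat (enorm y))"
    by (rule ex_has_least_nat[of _ "of_int p"]) (use pI p0 in auto)
  then obtain g where g: "g \<in> I" "g \<noteq> 0"
    and min: "\<And>y. y \<in> I \<Longrightarrow> y \<noteq> 0 \<Longrightarrow> enorm g \<le> enorm y"
    using enorm_nonneg by (metis nat_le_eq_zle le_less)
  have g_dvd: "g dvd y" if "y \<in> I" for y
  proof -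
    obtain q where "enorm (y - q * g) < enorm g" using euclidean_division[OF g(2)] .
    moreover have "y - q * g \<in> I" using closed that g(1) by blast
    ultimately have "y - q * g = 0" using min by (meson not_le)
    thus ?thesis by simp
  qed
  obtain h where h: "of_int p = g * h" using g_dvd[OF pI] by (elim dvdE)
  have gh: "p\<^sup>2 = enorm g * enorm h" by (metis h enorm_mult enorm_of_int)
  obtain k where k: "k \<le> 2" "enorm g = p ^ k"
  proof -
    have "enorm g dvd p\<^sup>2" using gh by simp
    then obtain k where "k \<le> 2" "normalize (enorm g) = normalize (p ^ k)"
      using divides_primepow_weak[OF p] by blast
    thus ?thesis using that p0 by simp
  qed
  consider "k = 0" | "k = 1" | "k = 2" using k(1) by linarith
  thus ?thesis
  proof cases
    case 1
    hence unit: "econj g * g = 1" using k(2) mult_econj[of g] by (simp add: mult.commute)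
    obtain r s where rs: "g = of_int p * r + u * s" using g(1) unfolding I_def by blast
    obtain m where m: "enorm u = p * m" using dvd by (elim dvdE)
    have "econj u = econj g * (econj u * g)" using unit by (simp add: mult.left_commute)
    also have "econj u * g = of_int p * (econj u * r) + (u * econj u) * s"
      unfolding rs by (simp add: algebra_simps)
    also have "\<dots> = of_int p * (econj u * r + of_int m * s)"
      by (simp add: mult_econj m algebra_simps)
    finally have "of_int p dvd econj u" by (metis dvd_triv_left mult.left_commute)
    hence "econj (of_int p) dvd econj (econj u)" by (rule econj_dvd_econj)
    with ndvd show ?thesis by simp
  next
    case 2
    thus ?thesis using that k(2) by simp
  next
    case 3
    hence "enorm h = 1" using gh k(2) p0 by simp
    hence "of_int p * econj h = g" unfolding h using mult_econj[of h] by (simp add: mult.assoc)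
    hence "of_int p dvd g" by (metis dvd_triv_left)
    thus ?thesis using g_dvd[OF uI] ndvd dvd_trans by blast
  qed
qed

text \<open>Modulo \<open>t\<close> the norm \<open>s\<^sup>2 + s t + t\<^sup>2\<close> is \<open>s\<^sup>2\<close>.\<close>

lemma of_int_dvd_if_dvd_snd_coord:
  fixes p :: int
  assumes p: "prime p" and dvd: "p dvd enorm u" and snd: "p dvd snd_coord u"
  shows "of_int p dvd u"
proof -
  have "enorm u = (fst_coord u)\<^sup>2 + (fst_coord u + snd_coord u) * snd_coord u"
    by (simp add: enorm_def algebra_simps power2_eq_square)
  hence "p dvd (fst_coord u)\<^sup>2"
    using dvd snd by (simp add: dvd_add_left_iff)
  hence "p dvd fst_coord u" using p prime_dvd_power by blast
  with snd show ?thesis using of_int_dvd_Eis_iff[of p "fst_coord u" "snd_coord u"] by simp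
qed

text \<open>
  Write \<open>w'\<close> for the conjugate of \<open>w\<close>. Since \<open>w w' = p\<close>, it suffices to show that \<open>p\<close>
  divides \<open>u w'\<close> or \<open>u w\<close>. Both have norm divisible by \<open>p\<close>, so by the preceding lemma only
  their second coordinates matter, and the product of these is a combination of \<open>N(u)\<close> and
  \<open>N(w)\<close>.
\<close>

lemma split_off_factor:
  fixes p :: int
  assumes p: "prime p" and w: "enorm w = p" and dvd: "p dvd enorm u"
  obtains r v where "r = w \<or> r = econj w" "u = r * v" "enorm u = p * enorm v"
proof -
  have p0: "p \<noteq> 0" using p by auto
  have cancel: "r dvd u" if r: "enorm r = p" and d: "p dvd snd_coord (u * econj r)" for r
  proof -
    have "p dvd enorm (u * econj r)" using r by (simp add: enorm_mult)
    hence "of_int p dvd u * econj r" using of_int_dvd_if_dvd_snd_coord p d by blast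
    then have "r * econj r dvd u * econj r" using mult_econj[of r] r by simp
    moreover have "econj r \<noteq> 0" using r p0 by (metis enorm_econj enorm_eq_0_iff)
    ultimately show ?thesis by simp
  qed
  have "snd_coord (u * econj w) * snd_coord (u * w)
      = (snd_coord u)\<^sup>2 * enorm w - (snd_coord w)\<^sup>2 * enorm u"
    by (simp add: eisenstein_ops econj_def enorm_def algebra_simps power2_eq_square)
  hence "p dvd snd_coord (u * econj w) * snd_coord (u * w)" using w dvd by simp
  hence "p dvd snd_coord (u * econj w) \<or> p dvd snd_coord (u * w)"
    using p by (simp add: prime_dvd_mult_iff)
  hence "w dvd u \<or> econj w dvd u" using cancel[of w] cancel[of "econj w"] w by auto
  then obtain r v where rv: "r = w \<or> r = econj w" "u = r * v" by (auto elim!: dvdE)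
  hence "enorm u = p * enorm v" using w by (auto simp: enorm_mult)
  with rv that show ?thesis by blast
qed

section \<open>Elements whose norm is a cube\<close>

text \<open>
  A prime factor \<open>p\<close> of \<open>z\<close> allows three factors of norm \<open>p\<close> to be split off from \<open>u\<close> if
  \<open>p\<close> is a norm, and the factor \<open>p\<^sup>3\<close> otherwise. The norm of the cofactor is the cube of
  \<open>z / p\<close> or \<open>z / p\<^sup>2\<close>, and the form found for the cofactor extends to \<open>u\<close>. A unit \<open>u\<close> is
  handled by \<open>g = u\<close>, \<open>h = 1\<close>.
\<close>

lemma norm_cube_imp_form:
  assumes "enorm u = z ^ 3"
  shows "\<exists>g h. u = of_int (enorm g) * g * h ^ 3 \<and> z = enorm g * enorm h"
  using assms
proof (induction "nat z" arbitrary: u z rule: less_induct)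
  case less
  have z0: "z \<ge> 0" using less.prems enorm_nonneg[of u] by simp
  consider "z = 0" | "z = 1" | "z > 1" using z0 by linarith
  thus ?case
  proof cases
    case 1
    hence "u = of_int (enorm 0) * 0 * 1 ^ 3 \<and> z = enorm 0 * enorm 1"
      using less.prems by simp
    thus ?thesis by blast
  next
    case 2
    hence "u = of_int (enorm u) * u * 1 ^ 3 \<and> z = enorm u * enorm 1"
      using less.prems by simp
    thus ?thesis by blast
  next
    case 3
    then obtain p where p: "prime p" "p dvd z"
      using prime_factor_int[of z] by auto
    have p1: "p > 1" using p(1) by (simp add: prime_gt_1_int)
    obtain z' where z': "z = p * z'" using p(2) by (elim dvdE)
    have z'0: "z' > 0" using 3 p1 z' by (metis less_trans zero_less_mult_pos zero_less_one)
    have N: "enorm u = p * (p * (p * z' ^ 3))"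
      using less.prems z' by (simp add: power3_eq_cube)
    show ?thesis
    proof (cases "\<exists>w. enorm w = p")
      case True
      then obtain w where w: "enorm w = p" by blast
      obtain r1 u1 where 1: "r1 = w \<or> r1 = econj w" "u = r1 * u1" "enorm u = p * enorm u1"
        by (rule split_off_factor[OF p(1) w, of u]) (use N in auto)
      have N1: "enorm u1 = p * (p * z' ^ 3)" using 1(3) N p1 by simp
      obtain r2 u2 where 2: "r2 = w \<or> r2 = econj w" "u1 = r2 * u2" "enorm u1 = p * enorm u2"
        by (rule split_off_factor[OF p(1) w, of u1]) (use N1 in auto)
      have N2: "enorm u2 = p * z' ^ 3" using 2(3) N1 p1 by simp
      obtain r3 u3 where 3: "r3 = w \<or> r3 = econj w" "u2 = r3 * u3" "enorm u2 = p * enorm u3"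
        by (rule split_off_factor[OF p(1) w, of u2]) (use N2 in auto)
      have N3: "enorm u3 = z' ^ 3" using 3(3) N2 p1 by simp
      have "nat z' < nat z" using z' z'0 p1 by simp
      from less.hyps[OF this N3] obtain g h
        where gb: "u3 = of_int (enorm g) * g * h ^ 3" "z' = enorm g * enorm h" by blast
      have u: "u = r1 * r2 * r3 * u3" by (simp add: 1(2) 2(2) 3(2) mult.assoc)
      have ww: "w * econj w = of_int p" using mult_econj[of w] w by simp
      \<comment> \<open>Three factors that are not all equal contain both \<open>w\<close> and its conjugate; these two
        multiply to \<open>p\<close>, and the third one is \<open>r\<close>.\<close>
      have "(\<exists>r. enorm r = p \<and> r1 * r2 * r3 = r ^ 3) \<or>
            (\<exists>r. enorm r = p \<and> r1 * r2 * r3 = of_int p * r)"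
      proof (cases "r1 = r2 \<and> r2 = r3")
        case True
        hence "enorm r1 = p" "r1 * r2 * r3 = r1 ^ 3"
          using 1(1) w by (auto simp: power3_eq_cube)
        thus ?thesis by blast
      next
        case False
        hence "r1 * r2 * r3 = of_int p * w \<or> r1 * r2 * r3 = of_int p * econj w"
          unfolding ww[symmetric] using 1(1) 2(1) 3(1) by (elim disjE) (simp_all add: mult_ac)
        thus ?thesis using w enorm_econj by metis
      qed
      thus ?thesis
      proof (elim disjE exE conjE)
        fix r assume r: "enorm r = p" "r1 * r2 * r3 = r ^ 3"
        have "u = of_int (enorm g) * g * (r * h) ^ 3 \<and> z = enorm g * enorm (r * h)"
          unfolding u r(2) gb(1) z' gb(2) enorm_mult r(1) by (simp add: power_mult_distrib mult_ac)
        thus ?thesis by blast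
      next
        fix r assume r: "enorm r = p" "r1 * r2 * r3 = of_int p * r"
        have "u = of_int (enorm (r * g)) * (r * g) * h ^ 3 \<and> z = enorm (r * g) * enorm h"
          unfolding u r(2) gb(1) z' gb(2) enorm_mult r(1) by (simp add: mult_ac)
        thus ?thesis by blast
      qed
    next
      case False
      have inert: "\<exists>y. x = of_int p * y \<and> enorm x = p * (p * enorm y)" if x: "p dvd enorm x" for x
      proof -
        have "of_int p dvd x" using prime_is_norm[OF p(1) x] False by blast
        then obtain y where "x = of_int p * y" by (elim dvdE)
        thus ?thesis by (auto simp: enorm_mult power2_eq_square)
      qed
      \<comment> \<open>Splitting off \<open>p\<close> divides the norm by \<open>p\<^sup>2\<close>. After two steps the norm being a cube
        forces a second factor \<open>p\<close> in \<open>z\<close>, which makes the third step possible.\<close>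
      have "p dvd enorm u" using N by simp
      then obtain u1 where 1: "u = of_int p * u1" "enorm u = p * (p * enorm u1)"
        using inert by blast
      have N1: "enorm u1 = p * z' ^ 3" using 1(2) N p1 by simp
      then obtain u2 where 2: "u1 = of_int p * u2" "enorm u1 = p * (p * enorm u2)"
        using inert[of u1] by (metis dvd_triv_left)
      have N2: "z' ^ 3 = p * enorm u2" using 2(2) N1 p1 by simp
      hence "p dvd z'" using prime_dvd_power[OF p(1)] by (metis dvd_triv_left)
      then obtain z'' where z'': "z' = p * z''" by (elim dvdE)
      have N2': "enorm u2 = p * (p * z'' ^ 3)"
        using N2 p1 unfolding z'' by (simp add: power3_eq_cube mult_ac)
      then obtain u3 where 3: "u2 = of_int p * u3" "enorm u2 = p * (p * enorm u3)"
        using inert[of u2] by (metis dvd_triv_left)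
      have N3: "enorm u3 = z'' ^ 3" using 3(2) N2' p1 by simp
      have z''0: "z'' > 0" using z'' z'0 p1 by (metis less_trans zero_less_mult_pos zero_less_one)
      have "z'' < z'" using z'' z''0 p1 by simp
      moreover have "z' < z" using z' z'0 p1 by simp
      ultimately have "nat z'' < nat z" using z''0 by simp
      from less.hyps[OF this N3] obtain g h
        where gb: "u3 = of_int (enorm g) * g * h ^ 3" "z'' = enorm g * enorm h" by blast
      have "u = of_int (enorm g) * g * (of_int p * h) ^ 3 \<and> z = enorm g * enorm (of_int p * h)"
        unfolding 1(1) 2(1) 3(1) gb(1) z' z'' gb(2) enorm_mult enorm_of_int
        by (simp add: power_mult_distrib power2_eq_square power3_eq_cube mult_ac)
      thus ?thesis by blast
    qed
  qed
qed

lemma norm_cube_iff_form: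
  "enorm u = z ^ 3 \<longleftrightarrow> (\<exists>g h. u = of_int (enorm g) * g * h ^ 3 \<and> z = enorm g * enorm h)"
proof
  assume "\<exists>g h. u = of_int (enorm g) * g * h ^ 3 \<and> z = enorm g * enorm h"
  thus "enorm u = z ^ 3"
    by (auto simp: enorm_mult enorm_power power2_eq_square power3_eq_cube)
qed (rule norm_cube_imp_form)

section \<open>Translation to the equation\<close>

text \<open>
  If \<open>u = (x + y \<surd>-3) / 2 = s + t \<zeta>\<close>, then \<open>x = 2 s + t\<close> and \<open>y = t\<close>; expanding the normal
  form \<open>N(g) g h\<^sup>3\<close>, with \<open>g = c + d \<zeta>\<close> and \<open>h = a + b \<zeta>\<close>, in coordinates gives the polynomials of the parametrisation.
\<close>

lemma form_coordinates:
  defines "u \<equiv> \<lambda>a b c d. of_int (enorm (Eis c d)) * Eis c d * Eis a b ^ 3"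
  shows "2 * fst_coord (u a b c d) + snd_coord (u a b c d) = (c^2 + c*d + d^2) *
          (3 * a^2 * b * (c - d) + a^3 * (2*c + d) - b^3 * (2*c + d) - 3 * a * b^2 * (c + 2*d))"
    and "snd_coord (u a b c d) = (c^2 + c*d + d^2) *
          (3 * a * b^2 * c + a^3 * d - b^3 * d + 3 * a^2 * b * (c + d))"
proof -
  have cube: "Eis a b ^ 3 = Eis (a ^ 3 - 3 * a * b\<^sup>2 - b ^ 3) (3 * a\<^sup>2 * b + 3 * a * b\<^sup>2)"
    by (simp add: power3_eq_cube power2_eq_square eisenstein_ops algebra_simps)
  have u: "u a b c d = Eis
      ((c^2 + c*d + d^2) * (c * (a ^ 3 - 3 * a * b\<^sup>2 - b ^ 3) - d * (3 * a\<^sup>2 * b + 3 * a * b\<^sup>2)))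
      ((c^2 + c*d + d^2) * (3 * a * b^2 * c + a^3 * d - b^3 * d + 3 * a^2 * b * (c + d)))"
    unfolding u_def cube enorm_Eis of_int_eisenstein by (simp add: eisenstein_ops) algebra
  show "2 * fst_coord (u a b c d) + snd_coord (u a b c d) = (c^2 + c*d + d^2) *
          (3 * a^2 * b * (c - d) + a^3 * (2*c + d) - b^3 * (2*c + d) - 3 * a * b^2 * (c + 2*d))"
    unfolding u eisenstein.sel by algebra
  show "snd_coord (u a b c d) = (c^2 + c*d + d^2) *
          (3 * a * b^2 * c + a^3 * d - b^3 * d + 3 * a^2 * b * (c + d))"
    unfolding u by simp
qed

text \<open>
  The equation forces \<open>x\<close> and \<open>y\<close> to have equal parity, which is what makes
  \<open>(x + y \<surd>-3) / 2\<close> an Eisenstein integer.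
\<close>

lemma equation_iff_norm_cube:
  fixes x y z :: int
  shows "x\<^sup>2 + 3 * y\<^sup>2 = 4 * z ^ 3 \<longleftrightarrow>
    (\<exists>u. x = 2 * fst_coord u + snd_coord u \<and> y = snd_coord u \<and> enorm u = z ^ 3)"
proof
  assume eq: "x\<^sup>2 + 3 * y\<^sup>2 = 4 * z ^ 3"
  hence "even (x\<^sup>2 + 3 * y\<^sup>2)" by simp
  hence "even (x - y)" by simp
  then obtain s where s: "x - y = 2 * s" by (elim evenE)
  hence x: "x = 2 * s + y" by simp
  have "4 * enorm (Eis s y) = 4 * z ^ 3" using eq four_enorm[of "Eis s y"] by (simp add: x)
  thus "\<exists>u. x = 2 * fst_coord u + snd_coord u \<and> y = snd_coord u \<and> enorm u = z ^ 3"
    using x by (intro exI[of _ "Eis s y"]) simp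
qed (auto simp: four_enorm[symmetric])

theorem lemma1:
  fixes x y z :: int
  shows "x^2 + 3 * y^2 = 4 * z^3 \<longleftrightarrow>
    (\<exists>a b c d :: int.
      x = (c^2 + c*d + d^2) *
          (3 * a^2 * b * (c - d) + a^3 * (2*c + d) - b^3 * (2*c + d) - 3 * a * b^2 * (c + 2*d)) \<and>
      y = (c^2 + c*d + d^2) *
          (3 * a * b^2 * c + a^3 * d - b^3 * d + 3 * a^2 * b * (c + d)) \<and>
      z = (c^2 + c*d + d^2) * (a^2 + a*b + b^2))"
proof -
  let ?u = "\<lambda>g b. of_int (enorm g) * g * b ^ 3 :: eisenstein"
  have Eis_all: "(\<exists>g :: eisenstein. P g) \<longleftrightarrow> (\<exists>c d. P (Eis c d))" for P
    by (metis eisenstein.exhaust)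
  have "x^2 + 3 * y^2 = 4 * z^3 \<longleftrightarrow>
      (\<exists>g b. x = 2 * fst_coord (?u g b) + snd_coord (?u g b) \<and> y = snd_coord (?u g b) \<and>
        z = enorm g * enorm b)"
    unfolding equation_iff_norm_cube norm_cube_iff_form by blast
  also have "\<dots> \<longleftrightarrow> (\<exists>c d a b. x = 2 * fst_coord (?u (Eis c d) (Eis a b)) + snd_coord (?u (Eis c d) (Eis a b))
      \<and> y = snd_coord (?u (Eis c d) (Eis a b)) \<and> z = enorm (Eis c d) * enorm (Eis a b))"
    unfolding Eis_all ..
  finally show ?thesis
    unfolding form_coordinates(1) unfolding form_coordinates(2) unfolding enorm_Eis by blast
qed

end
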